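(* Let $d\ge1$ be an integer. Let $\phi$ be a gauge such that $\phi\succcurlyeq1$, i.e. $\limsup_{r\to0+}\phi(r)/r<\infty$. Let $\Omega\subseteq\mathbb{R}^d$ be a locally compact set with nonempty interior. For a typical function $f\in C(\Omega)$, the set $\{x\in\Omega:\operatorname{lip}_\phi f(x)=\infty\}$ does not have $\sigma$-finite $(d-1)$-dimensional Hausdorff measure $\mathscr{H}^{d-1}$.
   Context: A gauge is a non-decreasing right-continuous function $\phi\colon[0,\infty)\to[0,\infty)$ with $\phi(0)=0$ and $\phi(r)>0$ for $r>0$. $C(\Omega)$ is the space of continuous real functions on $\Omega$ with the compact-open topology. "For a typical $f$ ... holds" means: there is a comeager set $\mathcal{F}\subseteq C(\Omega)$ such that every $f\in\mathcal{F}$ has the property. Generalized little lip function: $\operatorname{lip}_\phi f(x)=\liminf_{r\to0+}\frac{\operatorname{diam}f(B(x,r))}{\phi(r)}$, where $B(x,r)$ is the closed ball in $\Omega$. $\mathscr{H}^0$ is the counting measure. *)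

theory Defs
  imports "HOL-Analysis.Analysis"
begin

(* Functions from [0,oo) to [0,oo) are modelled as functions on the reals whose values at
   negative arguments are irrelevant; the name gauge is taken by the integration library. *)
definition gauge_function :: "(real \<Rightarrow> real) \<Rightarrow> bool" where
  "gauge_function \<phi> \<longleftrightarrow>
     mono_on {0..} \<phi> \<and> (\<forall>r\<ge>0. continuous (at_right r) \<phi>) \<and> \<phi> 0 = 0 \<and> (\<forall>r>0. \<phi> r > 0)"

(* Extensional functions (constantly undefined off \<Omega>) represent maps with domain \<Omega> uniquely. *)
definition cont_funs :: "'a::topological_space set \<Rightarrow> ('a \<Rightarrow> real) set" where
  "cont_funs \<Omega> = {f \<in> extensional \<Omega>. continuous_on \<Omega> f}"

definition compact_open_topology :: "'a::topological_space set \<Rightarrow> ('a \<Rightarrow> real) topology" where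
  "compact_open_topology \<Omega> =
     topology_generated_by {{f \<in> cont_funs \<Omega>. f ` K \<subseteq> U} | K U. compact K \<and> K \<subseteq> \<Omega> \<and> open U}"

lemma topspace_compact_open_topology: "topspace (compact_open_topology \<Omega>) = cont_funs \<Omega>"
proof -
  have "cont_funs \<Omega> \<in> {{f \<in> cont_funs \<Omega>. f ` K \<subseteq> U} | K U. compact K \<and> K \<subseteq> \<Omega> \<and> open U}"
    by (rule CollectI, intro exI[of _ "{}"] exI[of _ "UNIV"]) auto
  then show ?thesis
    unfolding compact_open_topology_def topology_generated_by_topspace by blast
qed

definition nowhere_dense_in :: "'a topology \<Rightarrow> 'a set \<Rightarrow> bool" where
  "nowhere_dense_in X A \<longleftrightarrow> A \<subseteq> topspace X \<and> X interior_of (X closure_of A) = {}"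

definition meager_in :: "'a topology \<Rightarrow> 'a set \<Rightarrow> bool" where
  "meager_in X A \<longleftrightarrow> (\<exists>N :: nat \<Rightarrow> 'a set. (\<forall>n. nowhere_dense_in X (N n)) \<and> A = (\<Union>n. N n))"

definition comeager_in :: "'a topology \<Rightarrow> 'a set \<Rightarrow> bool" where
  "comeager_in X A \<longleftrightarrow> A \<subseteq> topspace X \<and> meager_in X (topspace X - A)"

(* The library's real-valued diameter is meaningful on bounded sets only. For f continuous on a
   locally compact \<Omega>, the sets f(B(x,r)) are bounded for all small r, so the liminf as r tends to
   0+ is the intended one. *)
definition little_lip ::
    "(real \<Rightarrow> real) \<Rightarrow> 'a::metric_space set \<Rightarrow> ('a \<Rightarrow> real) \<Rightarrow> 'a \<Rightarrow> ereal" where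
  "little_lip \<phi> \<Omega> f x =
     Liminf (at_right 0) (\<lambda>r. ereal (diameter (f ` (cball x r \<inter> \<Omega>)) / \<phi> r))"

(* The s-th power of the diameter, with 0 ^ 0 = 1 for singletons but 0 for the empty set, so that
   the 0-dimensional Hausdorff measure below is the counting measure. *)
definition diam_power :: "nat \<Rightarrow> 'a::metric_space set \<Rightarrow> ennreal" where
  "diam_power s C = (if C = {} then 0 else ennreal (diameter C ^ s))"

definition hausdorff_premeasure :: "nat \<Rightarrow> real \<Rightarrow> 'a::metric_space set \<Rightarrow> ennreal" where
  "hausdorff_premeasure s \<delta> A =
     (INF C \<in> {C :: nat \<Rightarrow> 'a set. A \<subseteq> (\<Union>i. C i) \<and> (\<forall>i. bounded (C i) \<and> diameter (C i) \<le> \<delta>)}.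
        \<Sum>i. diam_power s (C i))"

(* The Hausdorff (outer) measure, without normalising constant, which does not affect
   sigma-finiteness. *)
definition hausdorff_measure :: "nat \<Rightarrow> 'a::metric_space set \<Rightarrow> ennreal" where
  "hausdorff_measure s A = (SUP \<delta> \<in> {0<..}. hausdorff_premeasure s \<delta> A)"

(* The pieces need not be measurable: the Hausdorff measure is Borel regular, so each piece of
   finite measure lies in a Borel set of the same measure. *)
definition sigma_finite_hausdorff :: "nat \<Rightarrow> 'a::metric_space set \<Rightarrow> bool" where
  "sigma_finite_hausdorff s A \<longleftrightarrow>
     (\<exists>E :: nat \<Rightarrow> 'a set. A = (\<Union>n. E n) \<and> (\<forall>n. hausdorff_measure s (E n) < \<infinity>))"

end

theory Submission
  imports Defs
begin

text \<open>Since \<open>\<phi> r \<le> C r\<close> for small \<open>r\<close>, the ordinary little lip is finite wherever \<open>lip\<^sub>\<phi> f\<close> is.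
  A typical \<open>f\<close> is almost constant on finitely many small balls that nearly fill a fixed ball, at
  every scale \<open>2\<^sup>-\<^sup>n\<close>, so by Borel-Cantelli its little lip vanishes almost everywhere there. If the
  set where \<open>lip\<^sub>\<phi> f = \<infinity>\<close> were \<open>\<sigma>\<close>-finite for the \<open>(d-1)\<close>-dimensional Hausdorff measure, almost
  every line in a given coordinate direction would meet it in a countable set, and by Fubini would
  meet the exceptional null set in a null set. A continuous function of one variable whose
  little lip is finite off a countable set and zero almost everywhere maps intervals to null sets
  (Vitali covering), hence is constant. So \<open>f\<close> would take the same value at two points fixed in
  advance, which a typical \<open>f\<close> does not.\<close>


section \<open>Lower slopes of functions of one variable\<close>

text \<open>Up to a factor of 2 this says that the little lip of \<open>f\<close> at \<open>x\<close> is at most \<open>k\<close>; unlike with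
  \<open>diameter\<close>, nothing has to be assumed about the boundedness of \<open>f\<close>.\<close>
definition lower_slope_le :: "('a::metric_space \<Rightarrow> real) \<Rightarrow> 'a \<Rightarrow> real \<Rightarrow> bool" where
  "lower_slope_le f x k \<longleftrightarrow>
     (\<exists>\<^sub>F r in at_right 0. \<forall>y\<in>cball x r. \<bar>f y - f x\<bar> \<le> k * r)"

lemma lower_slope_leE:
  assumes "lower_slope_le f x k" "0 < d"
  obtains r where "0 < r" "r < d" "\<And>y. y \<in> cball x r \<Longrightarrow> \<bar>f y - f x\<bar> \<le> k * r"
proof -
  have "\<forall>\<^sub>F r in at_right (0::real). 0 < r \<and> r < d"
    using eventually_at_right[OF assms(2)] assms(2) by blast
  with assms(1) have "\<exists>\<^sub>F r in at_right 0. (\<forall>y\<in>cball x r. \<bar>f y - f x\<bar> \<le> k * r) \<and> 0 < r \<and> r < d"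
    unfolding lower_slope_le_def by (rule frequently_eventually_frequently)
  then show thesis using that by (auto dest: frequently_ex)
qed

lemma lower_slope_leI:
  assumes "\<And>d. 0 < d \<Longrightarrow> \<exists>r>0. r < d \<and> (\<forall>y\<in>cball x r. \<bar>f y - f x\<bar> \<le> k * r)"
  shows "lower_slope_le f x k"
  unfolding lower_slope_le_def frequently_def
proof
  assume "\<forall>\<^sub>F r in at_right 0. \<not> (\<forall>y\<in>cball x r. \<bar>f y - f x\<bar> \<le> k * r)"
  then obtain b where "0 < b" "\<And>r. 0 < r \<Longrightarrow> r < b \<Longrightarrow> \<not> (\<forall>y\<in>cball x r. \<bar>f y - f x\<bar> \<le> k * r)"
    by (auto simp: eventually_at_right_field)
  then show False using assms by blast
qed

text \<open>A unit-speed line is embedded isometrically, so each ball on the line maps into a ball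
  of the same radius in the space. This carries slope bounds over to the one-dimensional
  criterion.\<close>

lemma lower_slope_le_line:
  fixes f :: "'a::real_normed_vector \<Rightarrow> real"
  assumes "lower_slope_le f (x + t *\<^sub>R e) k" "norm e = 1"
  shows "lower_slope_le (\<lambda>s. f (x + s *\<^sub>R e)) t k"
proof -
  have *: "dist (x + t *\<^sub>R e) (x + s *\<^sub>R e) = dist t s" for s
    by (simp add: dist_norm flip: scaleR_left_diff_distrib) (simp add: assms(2))
  show ?thesis
    using assms(1) unfolding lower_slope_le_def
    by (rule frequently_elim1) (metis * mem_cball)
qed

text \<open>Vitali's covering lemma gives disjoint intervals inside \<open>U\<close> whose fivefold
  enlargements cover \<open>T\<close>. If slope radii are used for the enlargements, each of them
  has its image in an interval of length at most \<open>5 * k\<close> times that of the small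
  interval, and the small ones have total length at most that of \<open>U\<close>.\<close>

lemma image_covered_of_lower_slope_le:
  fixes g :: "real \<Rightarrow> real"
  assumes "0 \<le> k" and U: "open U" "U \<in> lmeasurable" "T \<subseteq> U"
    and slope: "\<And>t. t \<in> T \<Longrightarrow> lower_slope_le g t k"
  obtains W where "W \<in> lmeasurable" "g ` T \<subseteq> W" "measure lebesgue W \<le> 5 * k * measure lebesgue U"
proof -
  \<comment> \<open>Here \<open>5 * s\<close> is a radius at which the slope bound holds, so the
    oscillation estimate survives the enlargement by 5. The bound \<open>s \<le> 1\<close> supplies
    the bounded radii that Vitali's lemma asks for.\<close>
  define K where "K = {(t, s). t \<in> T \<and> 0 < s \<and> s \<le> 1 \<and> cball t s \<subseteq> U \<and>
      (\<forall>u\<in>cball t (5 * s). \<bar>g u - g t\<bar> \<le> 5 * k * s)}"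
  have cov: "T \<subseteq> (\<Union>p\<in>K. cball (fst p) (snd p))"
  proof
    fix t assume t: "t \<in> T"
    then obtain d where d: "0 < d" "cball t d \<subseteq> U" using U by (meson open_contains_cball subsetD)
    obtain r where r: "0 < r" "r < 5 * min d 1" "\<And>y. y \<in> cball t r \<Longrightarrow> \<bar>g y - g t\<bar> \<le> k * r"
      using lower_slope_leE[OF slope[OF t], of "5 * min d 1"] d by auto
    have "cball t (r / 5) \<subseteq> cball t d" using r by (intro subset_cball) auto
    with r d t have "(t, r / 5) \<in> K" unfolding K_def by auto
    moreover have "t \<in> cball t (r/5)" using r by simp
    ultimately show "t \<in> (\<Union>p\<in>K. cball (fst p) (snd p))" by force
  qed
  have K1: "0 < snd p \<and> snd p \<le> 1" if "p \<in> K" for p using that by (auto simp: K_def)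
  obtain C where C: "countable C" "C \<subseteq> K"
     "pairwise (\<lambda>p q. disjnt (cball (fst p) (snd p)) (cball (fst q) (snd q))) C"
     "T \<subseteq> (\<Union>p\<in>C. cball (fst p) (5 * snd p))"
    by (rule Vitali_covering_lemma_cballs[OF cov K1])
  define A where "A p = cball (g (fst p)) (5 * k * snd p)" for p
  have mA: "A p \<in> lmeasurable" for p by (simp add: A_def)
  have bound: "measure lebesgue (\<Union>p\<in>I. A p) \<le> 5 * k * measure lebesgue U" if I: "I \<subseteq> C" "finite I" for I
  proof -
    have IK: "p \<in> K" if "p \<in> I" for p using that I C by auto
    then have IU: "(\<Union>p\<in>I. cball (fst p) (snd p)) \<subseteq> U" unfolding K_def by fastforce
    have "measure lebesgue (\<Union>p\<in>I. A p) \<le> (\<Sum>p\<in>I. measure lebesgue (A p))"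
      using I mA by (intro measure_UNION_le) auto
    also have "\<dots> = (\<Sum>p\<in>I. 5 * k * measure lebesgue (cball (fst p) (snd p)))"
      \<comment> \<open>An interval of radius \<open>s\<close> has length \<open>2 * s\<close> and
        its \<open>A p\<close> has length \<open>10 * k * s\<close>.\<close>
      using K1[OF IK] assms(1) by (intro sum.cong) (auto simp: A_def cball_eq_atLeastAtMost less_imp_le)
    also have "\<dots> = 5 * k * measure lebesgue (\<Union>p\<in>I. cball (fst p) (snd p))"
      using I C(3) by (subst measure_UNION') (auto simp: sum_distrib_left intro: pairwise_subset)
    also have "\<dots> \<le> 5 * k * measure lebesgue U"
      using I(2) U(2) assms(1) IU
      by (intro mult_left_mono measure_mono_fmeasurable sets.finite_UN) auto
    finally show ?thesis .
  qed
  show thesis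
  proof
    show "(\<Union>p\<in>C. A p) \<in> lmeasurable" by (rule fmeasurable_UN_bound[OF C(1) mA bound])
    show "measure lebesgue (\<Union>p\<in>C. A p) \<le> 5 * k * measure lebesgue U"
      by (rule measure_UN_bound[OF C(1) mA bound])
    show "g ` T \<subseteq> (\<Union>p\<in>C. A p)"
    proof
      fix y assume "y \<in> g ` T"
      then obtain u where u: "u \<in> T" "y = g u" by auto
      with C(4) obtain p where p: "p \<in> C" "u \<in> cball (fst p) (5 * snd p)" by auto
      then have "p \<in> K" using C by auto
      then have "y \<in> A p" using p u by (auto simp: K_def A_def dist_real_def abs_minus_commute)
      with p show "y \<in> (\<Union>p\<in>C. A p)" by auto
    qed
  qed
qed

text \<open>Split the null set into countably many pieces on which one integer bounds the slope.
  Each piece lies in open sets of arbitrarily small measure, to which the covering estimate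
  applies.\<close>

lemma negligible_image_null:
  fixes g :: "real \<Rightarrow> real"
  assumes "negligible N" and slope: "\<And>t. t \<in> N \<Longrightarrow> \<exists>k. lower_slope_le g t k"
  shows "negligible (g ` N)"
proof -
  define M where "M n = {t \<in> N. lower_slope_le g t (real n)}" for n
  have "negligible (g ` M n)" for n
    unfolding negligible_outer_le
  proof (intro allI impI)
    fix e :: real assume e: "0 < e"
    have "negligible (M n)" using assms(1) by (rule negligible_subset) (auto simp: M_def)
    then have Mn: "negligible (M n)" "M n \<in> sets lebesgue"
      by (auto simp: negligible_imp_sets)
    \<comment> \<open>The summand 1 keeps the denominator positive for \<open>n = 0\<close>.\<close>
    have e': "0 < e / (5 * real n + 1)" using e by (intro divide_pos_pos) auto
    obtain U where U: "open U" "M n \<subseteq> U" "U - M n \<in> lmeasurable"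
      and U': "emeasure lebesgue (U - M n) < ennreal (e / (5 * real n + 1))"
      using sets_lebesgue_outer_open[OF Mn(2) e'] by metis
    \<comment> \<open>The sets \<open>U\<close> and \<open>U - M n\<close> differ by the null set
      \<open>M n\<close>, so smallness of the second passes to the first.\<close>
    have sd: "negligible ((U - M n - U) \<union> (U - (U - M n)))"
      using Mn(1) by (rule negligible_subset) auto
    have "measure lebesgue (U - M n) < e / (5 * real n + 1)"
      using U' U(3) e' by (simp add: emeasure_eq_measure2 ennreal_less_iff)
    then have mU: "U \<in> lmeasurable" "measure lebesgue U < e / (5 * real n + 1)"
      using lmeasurable_negligible_symdiff[OF U(3) sd] measure_negligible_symdiff[OF U(3) sd] by auto
    obtain W where W: "W \<in> lmeasurable" "g ` M n \<subseteq> W" "measure lebesgue W \<le> 5 * real n * measure lebesgue U"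
      using image_covered_of_lower_slope_le[OF _ U(1) mU(1) U(2), of "real n" g] by (auto simp: M_def)
    have "measure lebesgue W \<le> (5 * real n + 1) * measure lebesgue U"
      using W(3) by (simp add: distrib_right add_increasing2)
    also have "\<dots> \<le> e" using mU(2) by (simp add: field_simps)
    finally show "\<exists>T. g ` M n \<subseteq> T \<and> T \<in> lmeasurable \<and> measure lebesgue T \<le> e" using W by blast
  qed
  then have "negligible (\<Union>n. g ` M n)" by (intro negligible_countable_Union) auto
  moreover have "g ` N \<subseteq> (\<Union>n. g ` M n)"
  proof (intro image_subsetI)
    fix t assume t: "t \<in> N"
    then obtain k where k: "lower_slope_le g t k" using slope by blast
    obtain n where n: "k \<le> real n" using real_arch_simple by blast
    have "lower_slope_le g t (real n)"
    proof (rule lower_slope_leI)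
      fix d :: real assume "0 < d"
      from lower_slope_leE[OF k this] obtain r where
        r: "0 < r" "r < d" "\<And>y. y \<in> cball t r \<Longrightarrow> \<bar>g y - g t\<bar> \<le> k * r" by metis
      moreover have "k * r \<le> real n * r" using n r by (intro mult_right_mono) auto
      ultimately show "\<exists>r>0. r < d \<and> (\<forall>y\<in>cball t r. \<bar>g y - g t\<bar> \<le> real n * r)"
        by (meson order_trans)
    qed
    with t show "g t \<in> (\<Union>n. g ` M n)" by (auto simp: M_def)
  qed
  ultimately show ?thesis by (rule negligible_subset)
qed

text \<open>Here the open set stays fixed, a ball around \<open>T\<close>, and the slope
  \<open>k\<close> is made small.\<close>

lemma negligible_image_zero_slope:
  fixes g :: "real \<Rightarrow> real"
  assumes "bounded T" and slope: "\<And>t k. t \<in> T \<Longrightarrow> 0 < k \<Longrightarrow> lower_slope_le g t k"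
  shows "negligible (g ` T)"
  unfolding negligible_outer_le
proof (intro allI impI)
  fix e :: real assume e: "0 < e"
  obtain B where B: "0 < B" "T \<subseteq> ball 0 B" using bounded_subset_ballD[OF assms(1)] by metis
  define k where "k = e / (5 * measure lebesgue (ball 0 B :: real set) + 1)"
  have k: "0 < k" using e by (auto simp: k_def intro!: divide_pos_pos add_nonneg_pos)
  obtain W where W: "W \<in> lmeasurable" "g ` T \<subseteq> W"
    "measure lebesgue W \<le> 5 * k * measure lebesgue (ball 0 B :: real set)"
    using image_covered_of_lower_slope_le[OF _ open_ball _ B(2), of k g] slope k by auto
  have "5 * k * measure lebesgue (ball 0 B :: real set) \<le> k * (5 * measure lebesgue (ball 0 B :: real set) + 1)"
    using k by (simp add: algebra_simps)
  also have "\<dots> = e" unfolding k_def by (simp add: add_nonneg_eq_0_iff)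
  finally show "\<exists>W. g ` T \<subseteq> W \<and> W \<in> lmeasurable \<and> measure lebesgue W \<le> e"
    using W by (meson order_trans)
qed

text \<open>The image of the interval is null: the part off \<open>N\<close> has slope zero, the
  part in \<open>N\<close> off \<open>D\<close> is null with finite slopes, and the image of
  \<open>D\<close> is countable. By continuity the image is also connected, and a connected null set
  of reals has at most one point.\<close>

proposition constant_of_zero_lower_slope:
  fixes g :: "real \<Rightarrow> real"
  assumes "a \<le> b" and cont: "continuous_on {a..b} g"
    and "countable D" "negligible N"
    and finite: "\<And>t. t \<in> {a..b} - D \<Longrightarrow> \<exists>k. lower_slope_le g t k"
    and zero: "\<And>t k. t \<in> {a..b} - N \<Longrightarrow> 0 < k \<Longrightarrow> lower_slope_le g t k"
  shows "g a = g b"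
proof -
  have "negligible (g ` ({a..b} - N))"
    by (rule negligible_image_zero_slope[OF bounded_subset[OF bounded_closed_interval]]) (auto intro: zero)
  moreover have "negligible (g ` ({a..b} \<inter> N - D))"
    using assms(4) by (intro negligible_image_null) (auto intro: negligible_subset finite)
  moreover have "negligible (g ` D)"
    using countable_imp_null_set_lborel[of "g ` D"] assms(3)
    by (simp add: negligible_iff_null_sets null_sets_completionI)
  ultimately have "negligible (g ` ({a..b} - N) \<union> g ` ({a..b} \<inter> N - D) \<union> g ` D)"
    by (intro negligible_Un)
  then have neg: "negligible (g ` {a..b})" by (rule negligible_subset) auto
  have conn: "connected (g ` {a..b})" using cont by (rule connected_continuous_image) auto
  have ab: "g a \<in> g ` {a..b}" "g b \<in> g ` {a..b}" using assms(1) by auto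
  have "\<not> u < v" if "u \<in> g ` {a..b}" "v \<in> g ` {a..b}" for u v
  proof
    assume "u < v"
    have "negligible {u..v}"
      using neg connected_contains_Icc[OF conn that] by (auto intro: negligible_subset)
    with \<open>u < v\<close> show False using negligible_interval(1)[of u v] by simp
  qed
  with ab show ?thesis by (meson linorder_neqE_linordered_idom)
qed


section \<open>Sections along almost every line in a coordinate direction\<close>

text \<open>Lines are indexed by all base points \<open>x\<close> instead of points of a hyperplane,
  so Tonelli's theorem and translation invariance of Lebesgue measure suffice.\<close>

lemma AE_negligible_line:
  fixes N :: "'a::euclidean_space set"
  assumes "negligible N"
  shows "AE x in lborel. negligible {t. x + t *\<^sub>R e \<in> N}"
proof -
  obtain N' where N': "N' \<in> null_sets lborel" "N \<subseteq> N'"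
    using assms unfolding negligible_iff_null_sets
    by (meson null_sets_completion_iff2)
  then have [measurable]: "N' \<in> sets borel" by (auto simp: null_sets_def)
  have inner: "(\<integral>\<^sup>+x. indicator N' (x + t *\<^sub>R e) \<partial>lborel) = 0" for t
  proof -
    have "(\<integral>\<^sup>+x. indicator N' (x + t *\<^sub>R e) \<partial>lborel) =
        (\<integral>\<^sup>+x. indicator N' x \<partial>distr lborel borel ((+) (t *\<^sub>R e)))"
      by (subst nn_integral_distr) (auto simp: add.commute)
    also have "\<dots> = emeasure lborel N'"
      by (subst lborel_distr_plus) simp
    finally show ?thesis using N'(1) by auto
  qed
  have "(\<integral>\<^sup>+x. (\<integral>\<^sup>+t. indicator N' (x + t *\<^sub>R e) \<partial>lborel) \<partial>lborel) =
        (\<integral>\<^sup>+t. (\<integral>\<^sup>+x. indicator N' (x + t *\<^sub>R e) \<partial>lborel) \<partial>lborel)"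
    by (rule lborel_pair.Fubini'[symmetric]) measurable
  also have "\<dots> = 0" by (simp add: inner)
  finally have "(\<integral>\<^sup>+x. (\<integral>\<^sup>+t. indicator N' (x + t *\<^sub>R e) \<partial>lborel) \<partial>lborel) = 0" .
  then have "AE x in lborel. (\<integral>\<^sup>+t. indicator N' (x + t *\<^sub>R e) \<partial>(lborel :: real measure)) = 0"
    by (subst (asm) nn_integral_0_iff_AE) auto
  then show ?thesis
  proof (rule AE_mp[OF _ AE_I2], intro impI)
    fix x
    assume "(\<integral>\<^sup>+t. indicator N' (x + t *\<^sub>R e) \<partial>(lborel :: real measure)) = 0"
    then have "AE t in lborel. indicator N' (x + t *\<^sub>R e) = (0::ennreal)"
      by (subst (asm) nn_integral_0_iff_AE) auto
    then have "AE t in lborel. x + t *\<^sub>R e \<notin> N'"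
      by (simp add: indicator_eq_0_iff)
    then have "{t. x + t *\<^sub>R e \<in> N'} \<in> null_sets lborel"
      by (subst (asm) AE_iff_null) auto
    then have "negligible {t. x + t *\<^sub>R e \<in> N'}"
      by (simp add: negligible_iff_null_sets null_sets_completionI)
    then show "negligible {t. x + t *\<^sub>R e \<in> N}"
      by (rule negligible_subset) (use N'(2) in auto)
  qed
qed

text \<open>Moving along \<open>e\<close> leaves the other coordinates unchanged, so a base point
  whose line meets \<open>C\<close> agrees in them with a point of \<open>C\<close>. They range over
  a cube of side \<open>2 * diameter C\<close>, and the slab bounds the remaining one.\<close>

lemma box_around_line:
  fixes e :: "'a::euclidean_space"
  assumes "e \<in> Basis" "0 \<le> R" "bounded C"
  obtains B where "B \<in> sets borel"
    "emeasure lborel B \<le> ennreal (2 * R * 2 ^ (DIM('a) - 1)) * diam_power (DIM('a) - 1) C"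
    "\<And>x t. \<bar>x \<bullet> e\<bar> \<le> R \<Longrightarrow> x + t *\<^sub>R e \<in> C \<Longrightarrow> x \<in> B"
proof (cases "C = {}")
  case True
  then show ?thesis using that[of "{}"] by simp
next
  case False
  then obtain c where c: "c \<in> C" by auto
  define d where "d = diameter C"
  have d: "0 \<le> d" unfolding d_def by (rule diameter_ge_0[OF assms(3)])
  define l where "l = (\<Sum>b\<in>Basis. (if b = e then - R else c \<bullet> b - d) *\<^sub>R b)"
  define u where "u = (\<Sum>b\<in>Basis. (if b = e then R else c \<bullet> b + d) *\<^sub>R b)"
  have l: "l \<bullet> b = (if b = e then - R else c \<bullet> b - d)" if "b \<in> Basis" for b
    unfolding l_def using that by (simp add: inner_sum_left_Basis)
  have u: "u \<bullet> b = (if b = e then R else c \<bullet> b + d)" if "b \<in> Basis" for b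
    unfolding u_def using that by (simp add: inner_sum_left_Basis)
  show ?thesis
  proof
    show "cbox l u \<in> sets borel" by simp
    have "emeasure lborel (cbox l u) = ennreal (\<Prod>b\<in>Basis. (u - l) \<bullet> b)"
      using l u d assms(2) by (subst emeasure_lborel_cbox_eq) auto
    also have "(\<Prod>b\<in>Basis. (u - l) \<bullet> b) = (\<Prod>b\<in>Basis. if b = e then 2 * R else 2 * d)"
      by (intro prod.cong) (auto simp: inner_diff_left l u)
    also have "\<dots> = 2 * R * (\<Prod>b\<in>Basis - {e}. 2 * d)"
      using assms(1) by (subst prod.remove[of _ e]) auto
    also have "\<dots> = 2 * R * (2 * d) ^ (DIM('a) - 1)"
      using assms(1) by simp
    finally show "emeasure lborel (cbox l u) \<le> ennreal (2 * R * 2 ^ (DIM('a) - 1)) * diam_power (DIM('a) - 1) C"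
      using False d assms(2)
      by (simp add: diam_power_def d_def power_mult_distrib mult.assoc flip: ennreal_mult)
    fix x t assume x: "\<bar>x \<bullet> e\<bar> \<le> R" "x + t *\<^sub>R e \<in> C"
    show "x \<in> cbox l u"
      unfolding mem_box
    proof
      fix b :: 'a assume b: "b \<in> Basis"
      show "l \<bullet> b \<le> x \<bullet> b \<and> x \<bullet> b \<le> u \<bullet> b"
      proof (cases "b = e")
        case True
        then show ?thesis using b x by (auto simp: l u)
      next
        case False
        have "\<bar>(x + t *\<^sub>R e - c) \<bullet> b\<bar> \<le> norm (x + t *\<^sub>R e - c)" using b by (rule Basis_le_norm)
        also have "\<dots> \<le> d"
          using diameter_bounded_bound[OF assms(3) x(2) c] by (simp add: d_def dist_norm)
        finally show ?thesis
          using False b assms(1) by (simp add: l u algebra_simps inner_Basis abs_le_iff)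
      qed
    qed
  qed
qed

text \<open>Cover \<open>E\<close> by sets of diameter at most \<open>1/m\<close> and count the ones that the line through \<open>x\<close> meets.
  The integral of this count over a slab is bounded independently of \<open>m\<close>, so by Fatou its lower
  limit is finite almost everywhere; the lower limit bounds the number of points of \<open>E\<close> on the line.\<close>
lemma AE_line_inter_finite_bounded:
  fixes E :: "'a::euclidean_space set"
  assumes e: "e \<in> Basis" and fin: "hausdorff_measure (DIM('a) - 1) E < \<infinity>" and R: "0 \<le> R"
  shows "AE x in lborel. \<bar>x \<bullet> e\<bar> \<le> R \<longrightarrow> finite {t. x + t *\<^sub>R e \<in> E}"
proof -
  \<comment> \<open>Adding 1 makes \<open>M\<close> strictly larger than the measure, so that some
    cover has sum below \<open>M\<close> at every scale.\<close>
  define M where "M = hausdorff_measure (DIM('a) - 1) E + 1"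
  have M: "M < \<infinity>" using fin by (simp add: M_def ennreal_add_less_top)
  have "\<exists>C :: nat \<Rightarrow> 'a set. E \<subseteq> (\<Union>i. C i) \<and> (\<forall>i. bounded (C i) \<and> diameter (C i) \<le> inverse (Suc m)) \<and>
      (\<Sum>i. diam_power (DIM('a) - 1) (C i)) < M" for m
  proof -
    have "hausdorff_premeasure (DIM('a) - 1) (inverse (Suc m)) E \<le> hausdorff_measure (DIM('a) - 1) E"
      unfolding hausdorff_measure_def by (rule SUP_upper) simp
    also have "\<dots> < M" using fin unfolding M_def
      by (metis ennreal_add_left_cancel_less add.right_neutral zero_less_one infinity_ennreal_def)
    finally show ?thesis unfolding hausdorff_premeasure_def INF_less_iff by auto
  qed
  then obtain C :: "nat \<Rightarrow> nat \<Rightarrow> 'a set" where C: "\<And>m. E \<subseteq> (\<Union>i. C m i)" "\<And>m i. bounded (C m i)"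
    "\<And>m i. diameter (C m i) \<le> inverse (Suc m)"
    "\<And>m. (\<Sum>i. diam_power (DIM('a) - 1) (C m i)) < M"
    by metis
  define K where "K = ennreal (2 * R * 2 ^ (DIM('a) - 1))"
  have "\<exists>B. B \<in> sets borel \<and> emeasure lborel B \<le> K * diam_power (DIM('a) - 1) (C m i) \<and>
    (\<forall>x t. \<bar>x \<bullet> e\<bar> \<le> R \<longrightarrow> x + t *\<^sub>R e \<in> C m i \<longrightarrow> x \<in> B)" for m i
    using box_around_line[OF e R C(2)[of m i]] unfolding K_def by metis
  then obtain B where [measurable]: "\<And>m i. B m i \<in> sets borel"
    and B: "\<And>m i. emeasure lborel (B m i) \<le> K * diam_power (DIM('a) - 1) (C m i)"
    "\<And>m i x t. \<bar>x \<bullet> e\<bar> \<le> R \<Longrightarrow> x + t *\<^sub>R e \<in> C m i \<Longrightarrow> x \<in> B m i"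
    by metis
  \<comment> \<open>\<open>N m x\<close> is at least the number of indices \<open>i\<close> for
    which the line through \<open>x\<close> meets \<open>C m i\<close>.\<close>
  define N where "N m x = (\<Sum>i. indicator (B m i) x :: ennreal)" for m x
  have [measurable]: "N m \<in> borel_measurable borel" for m unfolding N_def by measurable
  have int: "(\<integral>\<^sup>+x. N m x \<partial>lborel) \<le> K * M" for m
  proof -
    have "(\<integral>\<^sup>+x. N m x \<partial>lborel) = (\<Sum>i. emeasure lborel (B m i))"
      unfolding N_def by (subst nn_integral_suminf) auto
    also have "\<dots> \<le> (\<Sum>i. K * diam_power (DIM('a) - 1) (C m i))"
      by (intro suminf_le B) auto
    also have "\<dots> = K * (\<Sum>i. diam_power (DIM('a) - 1) (C m i))" by simp
    also have "\<dots> \<le> K * M" using C(4)[of m] by (intro mult_left_mono) auto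
    finally show ?thesis .
  qed
  have "(\<integral>\<^sup>+x. liminf (\<lambda>m. N m x) \<partial>lborel) \<le> liminf (\<lambda>m. \<integral>\<^sup>+x. N m x \<partial>lborel)"
    by (rule nn_integral_liminf) auto
  also have "\<dots> \<le> K * M"
    using int by (intro Liminf_le always_eventually) auto
  also have "\<dots> < \<infinity>" using M by (simp add: K_def ennreal_mult_less_top)
  finally have "AE x in lborel. liminf (\<lambda>m. N m x) \<noteq> \<infinity>"
    by (intro nn_integral_noteq_infinite) auto
  then show ?thesis
  proof (rule AE_mp[OF _ AE_I2], intro impI)
    fix x assume lim: "liminf (\<lambda>m. N m x) \<noteq> \<infinity>" and x: "\<bar>x \<bullet> e\<bar> \<le> R"
    show "finite {t. x + t *\<^sub>R e \<in> E}"
    proof (rule ccontr)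
      assume inf: "infinite {t. x + t *\<^sub>R e \<in> E}"
      have "of_nat n \<le> liminf (\<lambda>m. N m x)" for n
      proof -
        obtain T where T: "finite T" "card T = n" "T \<subseteq> {t. x + t *\<^sub>R e \<in> E}"
          using infinite_arbitrarily_large[OF inf] by metis
        obtain \<eta> where \<eta>: "0 < \<eta>" "\<And>s t. s \<in> T \<Longrightarrow> t \<in> T \<Longrightarrow> s \<noteq> t \<Longrightarrow> \<eta> \<le> dist s t"
          using uniform_discrete_finite_iff[of T] T(1) unfolding uniform_discrete_def
          by (metis linorder_not_less)
        have "of_nat n \<le> N m x" if m: "inverse (Suc m) < \<eta>" for m
        proof -
          have "\<forall>t\<in>T. \<exists>i. x + t *\<^sub>R e \<in> C m i" using T(3) C(1)[of m] by blast
          then obtain i where i: "\<And>t. t \<in> T \<Longrightarrow> x + t *\<^sub>R e \<in> C m (i t)" by metis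
          \<comment> \<open>Once \<open>1/(m+1)\<close> is below the least distance in
            \<open>T\<close>, no set of the cover holds two of the chosen points, so the line meets
            at least \<open>n\<close> sets.\<close>
          have inj: "inj_on i T"
          proof (rule inj_onI, rule ccontr)
            fix s t assume st: "s \<in> T" "t \<in> T" "i s = i t" "s \<noteq> t"
            have "dist (x + s *\<^sub>R e) (x + t *\<^sub>R e) \<le> diameter (C m (i t))"
              using i[OF st(1)] i[OF st(2)] st(3) C(2) by (intro diameter_bounded_bound) auto
            moreover have "dist (x + s *\<^sub>R e) (x + t *\<^sub>R e) = dist s t"
              using e by (simp add: dist_norm flip: scaleR_left_diff_distrib)
            ultimately show False using \<eta>(2)[OF st(1,2,4)] C(3)[of m "i t"] m by simp
          qed
          have "of_nat n = (\<Sum>j\<in>i ` T. indicator (B m j) x :: ennreal)"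
          proof -
            have "(\<Sum>j\<in>i ` T. indicator (B m j) x :: ennreal) = (\<Sum>j\<in>i ` T. 1)"
              using B(2)[OF x i] by (intro sum.cong) (auto simp: indicator_def)
            also have "\<dots> = of_nat n" using T(2) card_image[OF inj] by simp
            finally show ?thesis by simp
          qed
          also have "\<dots> \<le> N m x"
            unfolding N_def using T(1) by (intro sum_le_suminf) auto
          finally show ?thesis .
        qed
        moreover have "\<forall>\<^sub>F m in sequentially. inverse (real (Suc m)) < \<eta>"
          using LIMSEQ_inverse_real_of_nat \<eta>(1) by (rule order_tendstoD)
        ultimately show ?thesis
          by (intro Liminf_bounded) (auto elim!: eventually_mono)
      qed
      then have "liminf (\<lambda>m. N m x) = \<infinity>"
        by (metis ennreal_SUP_of_nat_eq_top infinity_ennreal_def top.extremum_unique SUP_least)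
      with lim show False by simp
    qed
  qed
qed

lemma AE_line_inter_countable:
  fixes E :: "'a::euclidean_space set"
  assumes e: "e \<in> Basis" and "sigma_finite_hausdorff (DIM('a) - 1) E"
  shows "AE x in lborel. countable {t. x + t *\<^sub>R e \<in> E}"
proof -
  obtain A :: "nat \<Rightarrow> 'a set" where A: "E = (\<Union>n. A n)" "\<And>n. hausdorff_measure (DIM('a) - 1) (A n) < \<infinity>"
    using assms(2) unfolding sigma_finite_hausdorff_def by metis
  have "AE x in lborel. \<forall>n m::nat. \<bar>x \<bullet> e\<bar> \<le> real m \<longrightarrow> finite {t. x + t *\<^sub>R e \<in> A n}"
    unfolding AE_all_countable using AE_line_inter_finite_bounded[OF e A(2)] by simp
  then show ?thesis
  proof (rule AE_mp[OF _ AE_I2], intro impI)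
    fix x assume "\<forall>n m::nat. \<bar>x \<bullet> e\<bar> \<le> real m \<longrightarrow> finite {t. x + t *\<^sub>R e \<in> A n}"
    then have "finite {t. x + t *\<^sub>R e \<in> A n}" for n using real_arch_simple by blast
    then have "countable (\<Union>n. {t. x + t *\<^sub>R e \<in> A n})" by (simp add: countable_finite)
    also have "(\<Union>n. {t. x + t *\<^sub>R e \<in> A n}) = {t. x + t *\<^sub>R e \<in> E}" using A(1) by auto
    finally show "countable {t. x + t *\<^sub>R e \<in> E}" .
  qed
qed


section \<open>Category in the compact-open topology\<close>

lemma openin_compact_open_subbasis:
  assumes "compact K" "K \<subseteq> \<Omega>" "open U"
  shows "openin (compact_open_topology \<Omega>) {f \<in> cont_funs \<Omega>. f ` K \<subseteq> U}"
  unfolding compact_open_topology_def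
  by (rule topology_generated_by_Basis) (use assms in blast)

lemma compact_open_neighbourhood:
  fixes \<Omega> :: "'a::topological_space set"
  assumes "openin (compact_open_topology \<Omega>) W" "f \<in> W"
  shows "\<exists>K \<epsilon>. compact K \<and> K \<subseteq> \<Omega> \<and> 0 < \<epsilon> \<and>
    (\<forall>g\<in>cont_funs \<Omega>. (\<forall>x\<in>K. \<bar>g x - f x\<bar> < \<epsilon>) \<longrightarrow> g \<in> W)"
proof -
  define S where "S = {{f \<in> cont_funs \<Omega>. f ` K \<subseteq> U} | K (U :: real set). compact K \<and> K \<subseteq> \<Omega> \<and> open U}"
  have "generate_topology_on S W"
    using assms(1) unfolding compact_open_topology_def S_def openin_topology_generated_by_iff .
  then show ?thesis using assms(2)
  proof induction
    case Empty
    then show ?case by simp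
  next
    case (Int a b)
    obtain K1 e1 where 1: "compact K1" "K1 \<subseteq> \<Omega>" "0 < e1"
      "\<And>g. g \<in> cont_funs \<Omega> \<Longrightarrow> \<forall>x\<in>K1. \<bar>g x - f x\<bar> < e1 \<Longrightarrow> g \<in> a"
      using Int by (metis IntD1)
    obtain K2 e2 where 2: "compact K2" "K2 \<subseteq> \<Omega>" "0 < e2"
      "\<And>g. g \<in> cont_funs \<Omega> \<Longrightarrow> \<forall>x\<in>K2. \<bar>g x - f x\<bar> < e2 \<Longrightarrow> g \<in> b"
      using Int by (metis IntD2)
    show ?case
      by (rule exI[of _ "K1 \<union> K2"], rule exI[of _ "min e1 e2"])
        (use 1 2 in \<open>auto intro: compact_Un\<close>)
  next
    case (UN \<A>)
    then obtain a where a: "a \<in> \<A>" "f \<in> a" by auto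
    show ?case using UN.IH[OF a] a(1) by (meson UnionI)
  next
    case (Basis s)
    then obtain K U where K: "s = {f \<in> cont_funs \<Omega>. f ` K \<subseteq> U}" "compact K" "K \<subseteq> \<Omega>" "open U"
      unfolding S_def by blast
    then have "continuous_on K f" "f ` K \<subseteq> U"
      using Basis.prems by (auto simp: cont_funs_def intro: continuous_on_subset)
    then obtain e where e: "0 < e" "(\<Union>y\<in>f ` K. ball y e) \<subseteq> U"
      using compact_subset_open_imp_ball_epsilon_subset[of "f ` K" U] K(2,4)
      by (metis compact_continuous_image)
    have "g \<in> s" if "g \<in> cont_funs \<Omega>" "\<forall>x\<in>K. \<bar>g x - f x\<bar> < e" for g
      using that e(2) by (force simp: K(1) dist_real_def abs_minus_commute)
    with K(2,3) e(1) show ?case by blast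
  qed
qed

text \<open>The complement of a dense open set is closed with empty interior, hence nowhere
  dense.\<close>

lemma comeager_in_Inter:
  fixes G :: "nat \<Rightarrow> 'a set"
  assumes "\<And>n. openin X (G n)"
    and "\<And>n W. openin X W \<Longrightarrow> W \<noteq> {} \<Longrightarrow> W \<inter> G n \<noteq> {}"
  shows "comeager_in X (\<Inter>n. G n)"
  unfolding comeager_in_def meager_in_def
proof (intro conjI exI allI)
  show "(\<Inter>n. G n) \<subseteq> topspace X" using assms(1)[of 0] openin_subset by fastforce
  show "topspace X - (\<Inter>n. G n) = (\<Union>n. topspace X - G n)" by auto
  fix n
  have "X interior_of (topspace X - G n) \<inter> G n = {}" using interior_of_subset by fastforce
  then have "X interior_of (topspace X - G n) = {}" using assms(2) openin_interior_of by metis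
  moreover have "X closure_of (topspace X - G n) = topspace X - G n"
    using assms(1) by (intro closure_of_closedin) auto
  ultimately show "nowhere_dense_in X (topspace X - G n)" by (simp add: nowhere_dense_in_def)
qed

lemma comeager_in_compact_open:
  fixes G :: "nat \<Rightarrow> ('a::topological_space \<Rightarrow> real) set"
  assumes op: "\<And>n. openin (compact_open_topology \<Omega>) (G n)"
    and dense: "\<And>n f \<epsilon>. f \<in> cont_funs \<Omega> \<Longrightarrow> 0 < \<epsilon> \<Longrightarrow> \<exists>g\<in>G n. \<forall>x\<in>\<Omega>. \<bar>g x - f x\<bar> < \<epsilon>"
  shows "comeager_in (compact_open_topology \<Omega>) (\<Inter>n. G n)"
proof (rule comeager_in_Inter[OF op])
  fix n W
  assume W: "openin (compact_open_topology \<Omega>) W" "W \<noteq> {}"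
  then obtain f where f: "f \<in> W" by auto
  then have fc: "f \<in> cont_funs \<Omega>"
    using openin_subset[OF W(1)] topspace_compact_open_topology by blast
  obtain K \<epsilon> where K: "K \<subseteq> \<Omega>" "0 < \<epsilon>" "\<And>g. g \<in> cont_funs \<Omega> \<Longrightarrow> \<forall>x\<in>K. \<bar>g x - f x\<bar> < \<epsilon> \<Longrightarrow> g \<in> W"
    using compact_open_neighbourhood[OF W(1) f] by metis
  obtain g where g: "g \<in> G n" "\<forall>x\<in>\<Omega>. \<bar>g x - f x\<bar> < \<epsilon>" using dense[OF fc K(2)] by metis
  moreover have "g \<in> cont_funs \<Omega>"
    using openin_subset[OF op] g(1) topspace_compact_open_topology by blast
  ultimately show "W \<inter> G n \<noteq> {}" using K by blast
qed

lemma openin_separating: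
  assumes "p \<in> \<Omega>" "q \<in> \<Omega>"
  shows "openin (compact_open_topology \<Omega>) {f \<in> cont_funs \<Omega>. f p \<noteq> f q}"
proof -
  \<comment> \<open>Two distinct values are separated by a threshold \<open>c\<close>, which makes
    the inequality a union of intersections of subbasic sets.\<close>
  define H where "H a b c = {f \<in> cont_funs \<Omega>. f ` {a} \<subseteq> {..<c}} \<inter> {f \<in> cont_funs \<Omega>. f ` {b} \<subseteq> {c<..}}"
    for a b and c :: real
  have "openin (compact_open_topology \<Omega>) (H a b c)" if "a \<in> \<Omega>" "b \<in> \<Omega>" for a b c
    unfolding H_def using that by (intro openin_Int openin_compact_open_subbasis) auto
  then have "openin (compact_open_topology \<Omega>) ((\<Union>c. H p q c) \<union> (\<Union>c. H q p c))"
    using assms by (intro openin_Un openin_Union) auto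
  also have "(\<Union>c. H p q c) \<union> (\<Union>c. H q p c) = {f \<in> cont_funs \<Omega>. f p \<noteq> f q}"
    unfolding H_def neq_iff using dense by (auto; blast)
  finally show ?thesis .
qed

lemma dense_separating:
  fixes \<Omega> :: "'a::metric_space set"
  assumes "p \<in> \<Omega>" "q \<in> \<Omega>" "p \<noteq> q" "f \<in> cont_funs \<Omega>" "0 < \<epsilon>"
  shows "\<exists>g\<in>{f \<in> cont_funs \<Omega>. f p \<noteq> f q}. \<forall>x\<in>\<Omega>. \<bar>g x - f x\<bar> < \<epsilon>"
proof (cases "f p = f q")
  case False
  then show ?thesis using assms by (intro bexI[of _ f]) auto
next
  case True
  \<comment> \<open>The perturbation vanishes at \<open>p\<close>, is positive at \<open>q\<close>,
    and is truncated to stay at most \<open>\<epsilon> / 2\<close>.\<close>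
  define g where "g = restrict (\<lambda>x. f x + \<epsilon> / 2 * min 1 (dist x p)) \<Omega>"
  have "continuous_on \<Omega> (\<lambda>x. f x + \<epsilon> / 2 * min 1 (dist x p))"
    using assms(4) unfolding cont_funs_def by (intro continuous_intros) auto
  then have "g \<in> cont_funs \<Omega>" unfolding cont_funs_def g_def
    by (auto cong: continuous_on_cong)
  moreover have "g p \<noteq> g q" using True assms by (auto simp: g_def dist_commute min_def)
  moreover have "\<bar>g x - f x\<bar> < \<epsilon>" if "x \<in> \<Omega>" for x
  proof -
    have "\<bar>g x - f x\<bar> = \<epsilon> / 2 * min 1 (dist x p)" using that assms(5) by (simp add: g_def abs_mult)
    also have "\<dots> \<le> \<epsilon> / 2 * 1" using assms(5) by (intro mult_left_mono) auto
    finally show ?thesis using assms(5) by simp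
  qed
  ultimately show ?thesis by auto
qed


section \<open>Functions that are almost constant on nearly filling balls\<close>

text \<open>The balls are enlarged by \<open>\<delta>\<close> so that the oscillation on the \<open>\<delta>\<close>-neighbourhood of every point
  of the original balls is small compared with \<open>\<delta>\<close>.\<close>
definition flat_on :: "'a::euclidean_space set \<Rightarrow> 'a set \<Rightarrow> real \<Rightarrow> ('a \<Rightarrow> real) \<Rightarrow> ('a \<times> real) set \<Rightarrow> real \<Rightarrow> bool" where
  "flat_on \<Omega> S k f P \<delta> \<longleftrightarrow> finite P \<and> 0 < \<delta> \<and> \<delta> < k \<and>
     (\<forall>p\<in>P. cball (fst p) (snd p + \<delta>) \<subseteq> \<Omega> \<and>
       (\<exists>v. f ` cball (fst p) (snd p + \<delta>) \<subseteq> ball v (k * \<delta>))) \<and>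
     measure lebesgue (S - (\<Union>p\<in>P. cball (fst p) (snd p))) < k"

definition flat_funs :: "'a::euclidean_space set \<Rightarrow> 'a set \<Rightarrow> real \<Rightarrow> ('a \<Rightarrow> real) set" where
  "flat_funs \<Omega> S k = {f \<in> cont_funs \<Omega>. \<exists>P \<delta>. flat_on \<Omega> S k f P \<delta>}"

text \<open>With \<open>P\<close>, \<open>\<delta>\<close> and the target centres \<open>v\<close>
  kept fixed, flatness amounts to finitely many subbasic conditions: closed balls are compact and
  the targets are open.\<close>

lemma openin_flat_funs: "openin (compact_open_topology \<Omega>) (flat_funs \<Omega> S k)"
proof (subst openin_subopen, intro ballI)
  fix f assume "f \<in> flat_funs \<Omega> S k"
  then obtain P \<delta> where f: "f \<in> cont_funs \<Omega>" and flat: "flat_on \<Omega> S k f P \<delta>"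
    unfolding flat_funs_def by blast
  then have P: "finite P" "\<And>p. p \<in> P \<Longrightarrow> cball (fst p) (snd p + \<delta>) \<subseteq> \<Omega>"
    by (auto simp only: flat_on_def)
  have "\<forall>p\<in>P. \<exists>v. f ` cball (fst p) (snd p + \<delta>) \<subseteq> ball v (k * \<delta>)"
    using flat by (auto simp only: flat_on_def)
  from bchoice[OF this] obtain v where
    v: "\<forall>p\<in>P. f ` cball (fst p) (snd p + \<delta>) \<subseteq> ball (v p) (k * \<delta>)" ..
  define H where "H p = {g \<in> cont_funs \<Omega>. g ` cball (fst p) (snd p + \<delta>) \<subseteq> ball (v p) (k * \<delta>)}" for p
  have H: "openin (compact_open_topology \<Omega>) (H p)" if "p \<in> P" for p
    unfolding H_def using P(2)[OF that] by (intro openin_compact_open_subbasis) auto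
  \<comment> \<open>For empty \<open>P\<close> the intersection over \<open>P\<close> is everything,
    and the factor \<open>cont_funs \<Omega>\<close> keeps \<open>W\<close> among the continuous
    functions.\<close>
  define W where "W = cont_funs \<Omega> \<inter> (\<Inter>p\<in>P. H p)"
  have "openin (compact_open_topology \<Omega>) W"
  proof -
    have *: "openin (compact_open_topology \<Omega>) (cont_funs \<Omega>)"
      using openin_topspace[of "compact_open_topology \<Omega>"]
      by (simp only: topspace_compact_open_topology)
    show ?thesis
    proof (cases "P = {}")
      case True
      then show ?thesis using * by (simp add: W_def)
    next
      case False
      then show ?thesis unfolding W_def using P(1) H * by (intro openin_Int openin_INT2)
    qed
  qed
  moreover have "f \<in> W" using f v by (simp add: W_def H_def)
  moreover have "W \<subseteq> flat_funs \<Omega> S k"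
  proof
    fix g assume g: "g \<in> W"
    then have "\<forall>p\<in>P. \<exists>v. g ` cball (fst p) (snd p + \<delta>) \<subseteq> ball v (k * \<delta>)"
      unfolding W_def H_def by blast
    with flat have "flat_on \<Omega> S k g P \<delta>" unfolding flat_on_def ball_conj_distrib by blast
    moreover have "g \<in> cont_funs \<Omega>" using g by (simp add: W_def)
    ultimately show "g \<in> flat_funs \<Omega> S k" unfolding flat_funs_def by blast
  qed
  ultimately show "\<exists>T. openin (compact_open_topology \<Omega>) T \<and> f \<in> T \<and> T \<subseteq> flat_funs \<Omega> S k"
    by (intro exI[of _ W] conjI)
qed

lemma flat_on_oscillation:
  assumes flat: "flat_on \<Omega> S k f P \<delta>" and x: "x \<in> (\<Union>p\<in>P. cball (fst p) (snd p))"
    and y: "y \<in> cball x \<delta>"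
  shows "\<bar>f y - f x\<bar> \<le> 2 * k * \<delta>"
proof -
  have pos: "0 < \<delta>" using flat by (simp only: flat_on_def)
  obtain p where p: "p \<in> P" "x \<in> cball (fst p) (snd p)" using x by blast
  have "\<exists>v. f ` cball (fst p) (snd p + \<delta>) \<subseteq> ball v (k * \<delta>)"
    using flat p(1) by (simp only: flat_on_def)
  then obtain v where v: "f ` cball (fst p) (snd p + \<delta>) \<subseteq> ball v (k * \<delta>)" ..
  have near: "dist v (f z) < k * \<delta>" if "z \<in> cball x \<delta>" for z
  proof -
    have "z \<in> cball (fst p) (snd p + \<delta>)"
      using that p(2) dist_triangle[of "fst p" z x] by simp
    then have "f z \<in> ball v (k * \<delta>)" using v by (rule imageI[THEN subsetD[rotated]])
    then show ?thesis by simp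
  qed
  have "dist v (f x) < k * \<delta>" using near[of x] pos by simp
  have "\<bar>f y - f x\<bar> \<le> dist v (f y) + dist v (f x)" by (simp add: dist_real_def)
  also have "\<dots> \<le> k * \<delta> + k * \<delta>" using near[OF y] \<open>dist v (f x) < k * \<delta>\<close> by linarith
  finally show ?thesis by (simp add: algebra_simps)
qed

text \<open>The uncovered parts have summable measure, so by Borel-Cantelli almost every
  \<open>x\<close> in \<open>S\<close> lies in the balls of \<open>P n\<close> for all large
  \<open>n\<close>. There the oscillation at radius \<open>\<delta> n\<close> is at most
  \<open>2 * (1/2) ^ n * \<delta> n\<close>, and \<open>\<delta> n\<close> tends to 0.\<close>

lemma lower_slope_le_of_flat:
  fixes f :: "'a::euclidean_space \<Rightarrow> real"
  assumes S: "S \<in> lmeasurable" and f: "\<And>n. f \<in> flat_funs \<Omega> S ((1/2) ^ n)"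
  shows "negligible {x \<in> S. \<not> (\<forall>k>0. lower_slope_le f x k)}"
proof -
  have "\<forall>n. \<exists>P \<delta>. flat_on \<Omega> S ((1/2) ^ n) f P \<delta>"
    using f unfolding flat_funs_def by blast
  then obtain P \<delta> where flat: "\<And>n. flat_on \<Omega> S ((1/2) ^ n) f (P n) (\<delta> n)" by metis
  have P: "finite (P n)" "0 < \<delta> n" "\<delta> n < (1/2) ^ n"
    "measure lebesgue (S - (\<Union>p\<in>P n. cball (fst p) (snd p))) < (1/2) ^ n" for n
    using flat[of n] by (simp_all only: flat_on_def)
  define A where "A n = S - (\<Union>p\<in>P n. cball (fst p) (snd p))" for n
  have A: "A n \<in> lmeasurable" for n
    unfolding A_def using S P(1)[of n] by (intro fmeasurable_Diff sets.finite_UN) auto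
  have "AE x in lebesgue. \<forall>\<^sub>F n in sequentially. x \<in> space lebesgue - A n"
  proof (rule borel_cantelli_AE1)
    show "A n \<in> sets lebesgue" for n using A by auto
    show "emeasure lebesgue (A n) < \<infinity>" for n using fmeasurableD2[OF A] by (simp add: top.not_eq_extremum)
    show "summable (\<lambda>n. measure lebesgue (A n))"
    proof (rule summable_comparison_test')
      show "summable (\<lambda>n. (1/2::real) ^ n)" by (rule summable_geometric) simp
      show "norm (measure lebesgue (A n)) \<le> (1/2) ^ n" if "0 \<le> n" for n
        using P(4)[of n] by (simp add: A_def)
    qed
  qed
  then have "AE x in lebesgue. \<forall>\<^sub>F n in sequentially. x \<notin> A n" by simp
  then obtain N where N: "N \<in> null_sets lebesgue"
    "{x. \<not> (\<forall>\<^sub>F n in sequentially. x \<notin> A n)} \<subseteq> N"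
    unfolding eventually_ae_filter by auto
  have "lower_slope_le f x k" if x: "x \<in> S - N" "0 < k" for x k
  proof (rule lower_slope_leI)
    fix d :: real assume d: "0 < d"
    have lim: "(\<lambda>n. (1/2::real) ^ n) \<longlonglongrightarrow> 0" by (rule LIMSEQ_power_zero) simp
    have "\<forall>\<^sub>F n in sequentially. x \<notin> A n" using x N by blast
    moreover have "\<forall>\<^sub>F n in sequentially. (1/2) ^ n < d" "\<forall>\<^sub>F n in sequentially. (1/2) ^ n < k / 2"
      using order_tendstoD(2)[OF lim d] order_tendstoD(2)[OF lim half_gt_zero[OF x(2)]] .
    ultimately have "\<forall>\<^sub>F n in sequentially. x \<notin> A n \<and> (1/2) ^ n < d \<and> (1/2) ^ n < k / 2"
      by (intro eventually_conj)
    then obtain n where n: "x \<notin> A n" "(1/2) ^ n < d" "(1/2) ^ n < k / 2"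
      using eventually_happens'[OF sequentially_bot] by blast
    have "\<bar>f y - f x\<bar> \<le> k * \<delta> n" if "y \<in> cball x (\<delta> n)" for y
    proof -
      have "\<bar>f y - f x\<bar> \<le> 2 * (1/2) ^ n * \<delta> n"
        using n(1) x(1) that by (intro flat_on_oscillation[OF flat]) (auto simp: A_def)
      also have "\<dots> \<le> k * \<delta> n" using n(3) P(2)[of n] by (intro mult_right_mono) auto
      finally show ?thesis .
    qed
    then show "\<exists>r>0. r < d \<and> (\<forall>y\<in>cball x r. \<bar>f y - f x\<bar> \<le> k * r)"
      using P(2,3)[of n] n(2) by (intro exI[of _ "\<delta> n"]) auto
  qed
  then have "{x \<in> S. \<not> (\<forall>k>0. lower_slope_le f x k)} \<subseteq> N" by blast
  moreover have "negligible N" using N(1) by (simp add: negligible_iff_null_sets)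
  ultimately show ?thesis by (rule negligible_subset[rotated])
qed

text \<open>Otherwise the point dividing the segment of centres in the ratio \<open>r : r'\<close>
  would lie in both balls. The strict gap leaves room to enlarge disjoint balls.\<close>

lemma dist_gt_of_disjnt_cball:
  fixes c c' :: "'a::real_normed_vector"
  assumes "disjnt (cball c r) (cball c' r')" "0 < r" "0 < r'"
  shows "r + r' < dist c c'"
proof (rule ccontr)
  assume le: "\<not> r + r' < dist c c'"
  define z where "z = c + (r / (r + r')) *\<^sub>R (c' - c)"
  have "dist c z = r * (dist c c' / (r + r'))"
    using assms by (simp add: z_def dist_norm norm_minus_commute)
  also have "\<dots> \<le> r * 1" using le assms by (intro mult_left_mono) (auto simp: divide_le_eq)
  finally have 1: "z \<in> cball c r" by simp
  have "c' - z = (r' / (r + r')) *\<^sub>R (c' - c)"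
  proof -
    have "1 - r / (r + r') = r' / (r + r')" using assms by (simp add: field_simps)
    then show ?thesis by (metis (no_types, lifting) z_def diff_diff_add scaleR_left_diff_distrib scaleR_one)
  qed
  then have "dist c' z = r' * (dist c c' / (r + r'))"
    using assms by (simp add: dist_norm norm_minus_commute)
  also have "\<dots> \<le> r' * 1" using le assms by (intro mult_left_mono) (auto simp: divide_le_eq)
  finally have "z \<in> cball c' r'" by simp
  with 1 assms(1) show False by (auto simp: disjnt_iff)
qed

text \<open>Vitali's covering theorem gives a countable disjoint family covering \<open>S\<close> up
  to a null set. Radii below \<open>d\<close> keep its union bounded, so a finite subfamily already
  carries all but \<open>k\<close> of the measure of the union.\<close>

lemma finite_disjoint_cballs_cover:
  fixes S :: "'a::euclidean_space set"
  assumes S: "S \<in> lmeasurable" "bounded S" and "0 < k" "0 < d"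
  obtains P where "finite P" "\<forall>p\<in>P. fst p \<in> S \<and> 0 < snd p \<and> snd p < d"
    "pairwise (\<lambda>p q. disjnt (cball (fst p) (snd p)) (cball (fst q) (snd q))) P"
    "measure lebesgue (S - (\<Union>p\<in>P. cball (fst p) (snd p))) < k"
proof -
  define K where "K = {p. fst p \<in> S \<and> 0 < snd p \<and> snd p < d}"
  have K1: "0 < snd p" if "p \<in> K" for p using that by (simp add: K_def)
  have K2: "\<exists>p. p \<in> K \<and> x \<in> cball (fst p) (snd p) \<and> snd p < e" if "x \<in> S" "0 < e" for x e
    by (rule exI[of _ "(x, min d e / 2)"]) (use that assms in \<open>auto simp: K_def\<close>)
  obtain C where C: "countable C" "C \<subseteq> K"
     "pairwise (\<lambda>p q. disjnt (cball (fst p) (snd p)) (cball (fst q) (snd q))) C"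
     "negligible (S - (\<Union>p\<in>C. cball (fst p) (snd p)))"
    by (rule Vitali_covering_theorem_cballs[of K snd S fst, OF K1 K2])
  define \<D> where "\<D> = (\<lambda>p. cball (fst p) (snd p)) ` C"
  obtain x0 B where B: "S \<subseteq> cball x0 B" using S(2) unfolding bounded_subset_cball by (metis bounded_subset_cball S(2))
  have sub: "\<Union>\<D> \<subseteq> cball x0 (B + d)"
  proof
    fix y assume "y \<in> \<Union>\<D>"
    then obtain p where p: "p \<in> K" "dist (fst p) y \<le> snd p" using C(2) by (auto simp: \<D>_def)
    then have "dist x0 (fst p) \<le> B" "snd p < d" using B by (auto simp: K_def)
    with p(2) dist_triangle[of x0 y "fst p"] show "y \<in> cball x0 (B + d)" by simp
  qed
  have meas: "D \<in> lmeasurable" if "D \<in> \<D>" for D using that by (auto simp: \<D>_def)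
  have cntD: "countable \<D>" using C(1) by (simp add: \<D>_def)
  have U: "\<Union>\<D> \<in> lmeasurable"
    using sub meas cntD by (intro fmeasurableI2[OF lmeasurable_cball sub] sets.countable_Union) auto
  have bound: "measure lebesgue (\<Union>D') \<le> measure lebesgue (cball x0 (B + d))" if "D' \<subseteq> \<D>" "finite D'" for D'
    using that sub meas by (intro measure_mono_fmeasurable sets.finite_Union) auto
  obtain D' where D': "D' \<subseteq> \<D>" "finite D'"
    "measure lebesgue (\<Union>\<D>) - k < measure lebesgue (\<Union>D')"
    by (rule measure_countable_Union_approachable[OF cntD assms(3) meas bound])
  obtain P where P: "P \<subseteq> C" "finite P" "D' = (\<lambda>p. cball (fst p) (snd p)) ` P"
    using finite_subset_image[OF D'(2) D'(1)[unfolded \<D>_def]] by (elim exE conjE bexE)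
  have fD: "\<Union>D' \<in> lmeasurable" using D' meas by (intro fmeasurable.finite_Union) auto
  show thesis
  proof
    show "finite P" by fact
    show "\<forall>p\<in>P. fst p \<in> S \<and> 0 < snd p \<and> snd p < d" using P C by (auto simp: K_def)
    show "pairwise (\<lambda>p q. disjnt (cball (fst p) (snd p)) (cball (fst q) (snd q))) P"
      using C(3) P(1) by (rule pairwise_subset)
    define Z where "Z = S - \<Union>\<D>"
    have Z: "negligible Z" using C(4) by (simp add: Z_def \<D>_def)
    have "measure lebesgue (S - \<Union>D') \<le> measure lebesgue ((\<Union>\<D> - \<Union>D') \<union> Z)"
      using S(1) fD U Z negligible_iff_measure
      by (intro measure_mono_fmeasurable) (auto simp: Z_def)
    also have "\<dots> = measure lebesgue (\<Union>\<D> - \<Union>D')"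
      using Z U fD by (intro measure_Un_null_set) (auto simp: negligible_iff_null_sets)
    also have "\<dots> = measure lebesgue (\<Union>\<D>) - measure lebesgue (\<Union>D')"
      using U fD D'(1) by (intro measurable_measure_Diff) auto
    also have "\<dots> < k" using D'(3) by simp
    finally show "measure lebesgue (S - (\<Union>p\<in>P. cball (fst p) (snd p))) < k" using P(3) by simp
  qed
qed

text \<open>On slightly enlarged disjoint balls, \<open>f\<close> is replaced by its values at the
  centres. Uniform continuity makes the correction small, and Tietze's theorem extends it to the
  whole space with the same bound.\<close>

lemma dense_flat_funs:
  fixes \<Omega> :: "'a::euclidean_space set"
  assumes sub: "cball p0 (2 * R) \<subseteq> \<Omega>" "0 < R" and f: "f \<in> cont_funs \<Omega>" and pos: "0 < \<epsilon>" "0 < k"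
  shows "\<exists>g\<in>flat_funs \<Omega> (ball p0 R) k. \<forall>x\<in>\<Omega>. \<bar>g x - f x\<bar> < \<epsilon>"
proof -
  define Q where "Q = cball p0 (2 * R)"
  have fQ: "continuous_on Q f"
    using f sub by (auto simp: cont_funs_def Q_def intro: continuous_on_subset)
  then have "uniformly_continuous_on Q f"
    by (intro compact_uniformly_continuous) (auto simp: Q_def)
  then obtain \<theta> where \<theta>: "0 < \<theta>" "\<And>x y. x \<in> Q \<Longrightarrow> y \<in> Q \<Longrightarrow> dist x y < \<theta> \<Longrightarrow> dist (f x) (f y) < \<epsilon> / 2"
    using pos(1) unfolding uniformly_continuous_on_def by (metis half_gt_zero)
  \<comment> \<open>Radius plus enlargement stays below \<open>2 * d = min \<theta> R\<close>: the
    bound \<open>\<theta>\<close> controls the oscillation of \<open>f\<close> on each enlarged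
    ball, and \<open>R\<close> keeps it inside \<open>Q\<close>.\<close>
  define d where "d = min \<theta> R / 2"
  have d: "0 < d" using \<theta>(1) sub(2) by (simp add: d_def)
  obtain P where P: "finite P" "\<forall>p\<in>P. fst p \<in> ball p0 R \<and> 0 < snd p \<and> snd p < d"
    "pairwise (\<lambda>p q. disjnt (cball (fst p) (snd p)) (cball (fst q) (snd q))) P"
    "measure lebesgue (ball p0 R - (\<Union>p\<in>P. cball (fst p) (snd p))) < k"
    by (rule finite_disjoint_cballs_cover[OF lmeasurable_ball bounded_ball pos(2) d, of p0 R])
  \<comment> \<open>Finitely many pairs of balls have positive gaps, so one small enlargement keeps
    all of them disjoint.\<close>
  have "\<forall>\<^sub>F \<delta> in at_right (0::real). \<forall>p\<in>P. \<forall>q\<in>P. p \<noteq> q \<longrightarrow> cball (fst p) (snd p + \<delta>) \<inter> cball (fst q) (snd q + \<delta>) = {}"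
  proof (intro eventually_ball_finite P(1) ballI)
    fix p q assume pq: "p \<in> P" "q \<in> P"
    show "\<forall>\<^sub>F \<delta> in at_right (0::real). p \<noteq> q \<longrightarrow> cball (fst p) (snd p + \<delta>) \<inter> cball (fst q) (snd q + \<delta>) = {}"
    proof (cases "p = q")
      case True
      then show ?thesis by simp
    next
      case False
      define s where "s = dist (fst p) (fst q) - (snd p + snd q)"
      have "0 < s" unfolding s_def
        using dist_gt_of_disjnt_cball[of "fst p" "snd p" "fst q" "snd q"] P(2) P(3) pq False
        by (auto simp: pairwise_def)
      then have "\<forall>\<^sub>F \<delta> in at_right (0::real). \<delta> < s / 2"
        by (intro eventually_at_right_less order_tendstoD tendsto_ident_at) auto
      then show ?thesis
        by (rule eventually_mono) (auto intro!: disjoint_cballI simp: s_def)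
    qed
  qed
  moreover have "\<forall>\<^sub>F \<delta> in at_right (0::real). 0 < \<delta>" by (rule eventually_at_right_less)
  moreover have "\<forall>\<^sub>F \<delta> in at_right (0::real). \<delta> < min k d"
    using pos(2) d by (intro order_tendstoD tendsto_ident_at) auto
  ultimately have "\<forall>\<^sub>F \<delta> in at_right (0::real). (\<forall>p\<in>P. \<forall>q\<in>P. p \<noteq> q \<longrightarrow>
      cball (fst p) (snd p + \<delta>) \<inter> cball (fst q) (snd q + \<delta>) = {}) \<and> 0 < \<delta> \<and> \<delta> < min k d"
    by (intro eventually_conj)
  from eventually_happens'[OF trivial_limit_at_right_real this]
  obtain \<delta> where \<delta>: "\<forall>p\<in>P. \<forall>q\<in>P. p \<noteq> q \<longrightarrow> cball (fst p) (snd p + \<delta>) \<inter> cball (fst q) (snd q + \<delta>) = {}"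
    "0 < \<delta>" "\<delta> < k" "\<delta> < d"
    unfolding min_less_iff_conj by (elim exE conjE)
  define A where "A p = cball (fst p) (snd p + \<delta>)" for p :: "'a \<times> real"
  define T where "T = (\<Union>p\<in>P. A p)"
  have AQ: "A p \<subseteq> Q" "\<And>x. x \<in> A p \<Longrightarrow> dist (fst p) x < \<theta>" "fst p \<in> A p" if "p \<in> P" for p
  proof -
    have p: "dist p0 (fst p) < R" "0 < snd p" "snd p < d" using bspec[OF P(2) that] by auto
    show "fst p \<in> A p" using p \<delta>(2) by (simp add: A_def)
    show "dist (fst p) x < \<theta>" if "x \<in> A p" for x
      using that p \<delta>(4) unfolding A_def d_def by auto
    show "A p \<subseteq> Q"
    proof
      fix x assume "x \<in> A p"
      then show "x \<in> Q" using p \<delta>(4) dist_triangle[of p0 x "fst p"] unfolding A_def Q_def d_def by auto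
    qed
  qed
  \<comment> \<open>By disjointness the choice is unique, which makes \<open>v\<close> constant on
    each enlarged ball.\<close>
  define v where "v x = f (fst (SOME p. p \<in> P \<and> x \<in> A p))" for x
  have v: "v x = f (fst p)" if "p \<in> P" "x \<in> A p" for p x
  proof -
    have "(SOME q. q \<in> P \<and> x \<in> A q) = p"
    proof (rule some_equality)
      show "p \<in> P \<and> x \<in> A p" using that by blast
      show "q = p" if "q \<in> P \<and> x \<in> A q" for q
        using that \<open>p \<in> P\<close> \<open>x \<in> A p\<close> \<delta>(1) unfolding A_def by blast
    qed
    then show ?thesis by (simp add: v_def)
  qed
  have "continuous_on T v"
    unfolding T_def
  proof (rule continuous_on_closed_Union)
    show "finite P" by fact
    show "closed (A p)" for p by (simp add: A_def)
    show "continuous_on (A p) v" if "p \<in> P" for p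
      using v[OF that] by (simp cong: continuous_on_cong)
  qed
  moreover have "continuous_on T f" using AQ(1) by (intro continuous_on_subset[OF fQ]) (auto simp: T_def)
  ultimately have "continuous_on T (\<lambda>x. v x - f x)" by (intro continuous_intros)
  moreover have "closedin (top_of_set UNIV) T"
    using P(1) by (auto simp: T_def A_def intro!: closed_UN)
  moreover have "norm (v x - f x) \<le> \<epsilon> / 2" if xT: "x \<in> T" for x
  proof -
    obtain p where p: "p \<in> P" "x \<in> A p" using xT unfolding T_def by blast
    then have "dist (f (fst p)) (f x) < \<epsilon> / 2"
      using AQ[OF p(1)] by (intro \<theta>(2)) auto
    then show ?thesis using v[OF p] by (simp add: dist_norm)
  qed
  ultimately obtain h where h: "continuous_on UNIV h" "\<And>x. x \<in> T \<Longrightarrow> h x = v x - f x" "\<And>x. norm (h x) \<le> \<epsilon> / 2"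
    using Tietze[of T "\<lambda>x. v x - f x" UNIV "\<epsilon> / 2"] pos(1) by auto
  define g where "g = restrict (\<lambda>x. f x + h x) \<Omega>"
  have "continuous_on \<Omega> (\<lambda>x. f x + h x)"
    using f h(1) unfolding cont_funs_def by (intro continuous_intros) (auto intro: continuous_on_subset)
  then have "g \<in> cont_funs \<Omega>" unfolding cont_funs_def g_def by (auto cong: continuous_on_cong)
  moreover have "A p \<subseteq> \<Omega>" "g ` A p \<subseteq> ball (f (fst p)) (k * \<delta>)" if "p \<in> P" for p
  proof -
    show "A p \<subseteq> \<Omega>" using AQ(1)[OF that] sub by (auto simp: Q_def)
    then have "g x = f (fst p)" if "x \<in> A p" for x
    proof -
      have "x \<in> T" using that \<open>p \<in> P\<close> unfolding T_def by blast
      then show ?thesis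
        using that \<open>A p \<subseteq> \<Omega>\<close> v[OF \<open>p \<in> P\<close> that] h(2)[of x] by (auto simp: g_def)
    qed
    then show "g ` A p \<subseteq> ball (f (fst p)) (k * \<delta>)" using pos \<delta> by auto
  qed
  ultimately have gP: "g \<in> cont_funs \<Omega>" "\<forall>p\<in>P. cball (fst p) (snd p + \<delta>) \<subseteq> \<Omega> \<and>
      (\<exists>v. g ` cball (fst p) (snd p + \<delta>) \<subseteq> ball v (k * \<delta>))"
    unfolding A_def by blast+
  have "flat_on \<Omega> (ball p0 R) k g P \<delta>"
    unfolding flat_on_def by (intro conjI P(1,4) \<delta>(2,3) gP(2))
  with gP(1) have "g \<in> flat_funs \<Omega> (ball p0 R) k"
    unfolding flat_funs_def by blast
  moreover have "\<bar>g x - f x\<bar> < \<epsilon>" if "x \<in> \<Omega>" for x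
    using h(3)[of x] pos(1) that by (simp add: g_def)
  ultimately show ?thesis by blast
qed


section \<open>From finite little lip to equal values at two points\<close>

text \<open>A finite lower limit gives arbitrarily small \<open>r\<close> with image diameter below
  \<open>c * \<phi> r\<close>, and \<open>\<phi> r < C * r\<close> for all small \<open>r\<close>.
  At an interior point small balls lie in \<open>\<Omega>\<close> and have compact images, so
  \<open>diameter\<close> really bounds the oscillation.\<close>

lemma lower_slope_le_of_little_lip:
  fixes \<Omega> :: "'a::euclidean_space set"
  assumes gauge: "gauge_function \<phi>" and lim: "Limsup (at_right 0) (\<lambda>r. ereal (\<phi> r / r)) < \<infinity>"
    and f: "continuous_on \<Omega> f" and x: "x \<in> interior \<Omega>" and lip: "little_lip \<phi> \<Omega> f x \<noteq> \<infinity>"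
  shows "\<exists>k. lower_slope_le f x k"
proof -
  have "Limsup (at_right 0) (\<lambda>r. ereal (\<phi> r / r)) \<noteq> \<infinity>" using lim by simp
  then obtain C :: real where "Limsup (at_right 0) (\<lambda>r. ereal (\<phi> r / r)) < ereal C"
    unfolding less_PInf_Ex_of_nat by blast
  then have C: "\<forall>\<^sub>F r in at_right 0. \<phi> r / r < C"
    using Limsup_lessD by fastforce
  obtain c :: real where c: "little_lip \<phi> \<Omega> f x < ereal c"
    using lip unfolding less_PInf_Ex_of_nat by blast
  have lip_freq: "\<exists>\<^sub>F r in at_right 0. diameter (f ` (cball x r \<inter> \<Omega>)) / \<phi> r < c"
    unfolding frequently_def
  proof
    assume "\<forall>\<^sub>F r in at_right 0. \<not> diameter (f ` (cball x r \<inter> \<Omega>)) / \<phi> r < c"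
    then have "ereal c \<le> little_lip \<phi> \<Omega> f x"
      unfolding little_lip_def by (intro Liminf_bounded) (auto elim: eventually_mono)
    with c show False by simp
  qed
  obtain d where d: "0 < d" "cball x d \<subseteq> \<Omega>" using x by (auto simp: mem_interior_cball)
  have small: "\<forall>\<^sub>F r in at_right 0. r < d" using order_tendstoD(2)[OF tendsto_ident_at d(1)] .
  have "\<forall>\<^sub>F r in at_right 0. \<phi> r / r < C \<and> r < d \<and> 0 < r"
    using C small eventually_at_right_less by (intro eventually_conj)
  with lip_freq have "\<exists>\<^sub>F r in at_right 0. diameter (f ` (cball x r \<inter> \<Omega>)) / \<phi> r < c \<and> \<phi> r / r < C \<and> r < d \<and> 0 < r"
    by (rule frequently_eventually_frequently)
  then have "lower_slope_le f x (c * C)"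
    unfolding lower_slope_le_def
  proof (rule frequently_elim1, intro ballI)
    fix r y
    assume r: "diameter (f ` (cball x r \<inter> \<Omega>)) / \<phi> r < c \<and> \<phi> r / r < C \<and> r < d \<and> 0 < r"
      and y: "y \<in> cball x r"
    have \<phi>: "0 < \<phi> r" using gauge r by (simp add: gauge_function_def)
    have sub: "cball x r \<subseteq> \<Omega>" using d(2) r by (meson order_trans subset_cball less_imp_le)
    then have "compact (f ` (cball x r \<inter> \<Omega>))"
      using f by (intro compact_continuous_image continuous_on_subset[OF f]) (auto simp: Int_absorb2)
    then have bd: "bounded (f ` (cball x r \<inter> \<Omega>))" by (rule compact_imp_bounded)
    have c0: "0 < c" using r \<phi> diameter_ge_0[OF bd] by (meson divide_nonneg_pos le_less_trans)
    have "x \<in> cball x r \<inter> \<Omega>" "y \<in> cball x r \<inter> \<Omega>" using sub y r by auto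
    then have "\<bar>f y - f x\<bar> \<le> diameter (f ` (cball x r \<inter> \<Omega>))"
      using diameter_bounded_bound[OF bd imageI imageI] by (simp add: dist_real_def)
    also have "\<dots> \<le> c * \<phi> r" using r \<phi> by (simp add: divide_less_eq)
    also have "\<dots> \<le> c * (C * r)" using r c0 by (intro mult_left_mono) (auto simp: divide_less_eq)
    finally show "\<bar>f y - f x\<bar> \<le> c * C * r" by (simp add: mult.assoc)
  qed
  then show ?thesis by blast
qed

text \<open>For almost every \<open>x\<close> near \<open>p0\<close> the one-dimensional criterion
  applies on the segment from \<open>x\<close> in direction \<open>e\<close>, with countable
  \<open>D\<close> coming from \<open>E\<close> and null \<open>N\<close> from the flatness. The
  exceptional \<open>x\<close> form an open null set, which is empty, so the equality also holds at
  \<open>p0\<close> itself.\<close>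

lemma eq_endpoints_of_sigma_finite:
  fixes \<Omega> :: "'a::euclidean_space set"
  assumes f: "continuous_on \<Omega> f" and S: "ball p0 R \<subseteq> interior \<Omega>" and R: "0 < R" and e: "e \<in> Basis"
    and E: "sigma_finite_hausdorff (DIM('a) - 1) E"
    and finite: "\<And>x. x \<in> ball p0 R - E \<Longrightarrow> \<exists>k. lower_slope_le f x k"
    and flat: "negligible {x \<in> ball p0 R. \<not> (\<forall>k>0. lower_slope_le f x k)}"
  shows "f p0 = f (p0 + (R / 2) *\<^sub>R e)"
proof -
  define N where "N = {x \<in> ball p0 R. \<not> (\<forall>k>0. lower_slope_le f x k)}"
  have ne: "norm e = 1" using e by simp
  have inS: "x + t *\<^sub>R e \<in> ball p0 R" if "x \<in> ball p0 (R / 2)" "t \<in> {0..R / 2}" for x t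
    using that dist_triangle[of p0 "x + t *\<^sub>R e" x] ne by (simp add: dist_norm)
  have "AE x in lborel. x \<in> ball p0 (R / 2) \<longrightarrow> f x = f (x + (R / 2) *\<^sub>R e)"
    using AE_line_inter_countable[OF e E] AE_negligible_line[OF flat[folded N_def], of e]
  proof eventually_elim
    case (elim x)
    show ?case
    proof
      assume x: "x \<in> ball p0 (R / 2)"
      define g where "g t = f (x + t *\<^sub>R e)" for t
      have "g 0 = g (R / 2)"
      proof (rule constant_of_zero_lower_slope[of 0 "R / 2" g, OF _ _ elim])
        show "0 \<le> R / 2" using R by simp
        show "continuous_on {0..R / 2} g"
          unfolding g_def using inS[OF x] S interior_subset
          by (intro continuous_on_compose2[OF f] continuous_intros) blast
        show "\<exists>k. lower_slope_le g t k" if "t \<in> {0..R / 2} - {t. x + t *\<^sub>R e \<in> E}" for t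
          using that finite[of "x + t *\<^sub>R e"] inS[OF x, of t] lower_slope_le_line[OF _ ne, of f x t]
          unfolding g_def by auto
        show "lower_slope_le g t k" if "t \<in> {0..R / 2} - {t. x + t *\<^sub>R e \<in> N}" "0 < k" for t k
          using that inS[OF x, of t] lower_slope_le_line[OF _ ne, of f x t k]
          unfolding g_def N_def by auto
      qed
      then show "f x = f (x + (R / 2) *\<^sub>R e)" by (simp add: g_def)
    qed
  qed
  then have "AE x in lborel. x \<notin> {x \<in> ball p0 (R / 2). f x \<noteq> f (x + (R / 2) *\<^sub>R e)}"
    by eventually_elim auto
  moreover have op: "open {x \<in> ball p0 (R / 2). f x \<noteq> f (x + (R / 2) *\<^sub>R e)}"
  proof -
    have sub: "x + t *\<^sub>R e \<in> \<Omega>" if "x \<in> ball p0 (R / 2)" "t \<in> {0..R / 2}" for x t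
      using inS[OF that] S interior_subset by blast
    have "continuous_on (ball p0 (R / 2)) f"
      using sub[of _ 0] R by (intro continuous_on_subset[OF f]) auto
    moreover have "continuous_on (ball p0 (R / 2)) (\<lambda>x. f (x + (R / 2) *\<^sub>R e))"
      using sub[of _ "R / 2"] R
      by (intro continuous_on_compose2[OF f, of _ "\<lambda>x. x + (R / 2) *\<^sub>R e"] continuous_intros) auto
    ultimately have "continuous_on (ball p0 (R / 2)) (\<lambda>x. f x - f (x + (R / 2) *\<^sub>R e))"
      by (rule continuous_on_diff)
    then have "open (ball p0 (R / 2) \<inter> (\<lambda>x. f x - f (x + (R / 2) *\<^sub>R e)) -` (- {0}))"
      by (rule continuous_open_preimage) auto
    also have "ball p0 (R / 2) \<inter> (\<lambda>x. f x - f (x + (R / 2) *\<^sub>R e)) -` (- {0}) =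
        {x \<in> ball p0 (R / 2). f x \<noteq> f (x + (R / 2) *\<^sub>R e)}" by auto
    finally show ?thesis .
  qed
  ultimately have "{x \<in> ball p0 (R / 2). f x \<noteq> f (x + (R / 2) *\<^sub>R e)} \<in> null_sets lborel"
    by (subst (asm) AE_iff_null_sets[symmetric]) auto
  then have "negligible {x \<in> ball p0 (R / 2). f x \<noteq> f (x + (R / 2) *\<^sub>R e)}"
    by (simp add: negligible_iff_null_sets null_sets_completionI)
  then have "{x \<in> ball p0 (R / 2). f x \<noteq> f (x + (R / 2) *\<^sub>R e)} = {}"
    using op open_not_negligible by blast
  then show ?thesis using R by auto
qed

theorem theorem3p4:
  fixes \<phi> :: "real \<Rightarrow> real" and \<Omega> :: "'a::euclidean_space set"
  assumes "gauge_function \<phi>"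
    and "Limsup (at_right 0) (\<lambda>r. ereal (\<phi> r / r)) < \<infinity>"
    and "locally compact \<Omega>"
    and "interior \<Omega> \<noteq> {}"
  shows "\<exists>F. comeager_in (compact_open_topology \<Omega>) F \<and>
           (\<forall>f\<in>F. \<not> sigma_finite_hausdorff (DIM('a) - 1) {x \<in> \<Omega>. little_lip \<phi> \<Omega> f x = \<infinity>})"
proof -
  obtain p0 where "p0 \<in> interior \<Omega>" using assms(4) by blast
  then obtain R0 where p0: "0 < R0" "cball p0 R0 \<subseteq> interior \<Omega>"
    using open_contains_cball[THEN iffD1, OF open_interior] by blast
  \<comment> \<open>Halving \<open>R0\<close> places the ball of radius \<open>2 * R\<close> in
    \<open>\<Omega>\<close>, as the density of the flat functions requires.\<close>
  define R where "R = R0 / 2"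
  have R: "0 < R" "cball p0 (2 * R) \<subseteq> \<Omega>" "ball p0 R \<subseteq> interior \<Omega>"
    using p0 interior_subset[of \<Omega>] by (auto simp: R_def subset_iff)
  obtain e :: 'a where e: "e \<in> Basis" using nonempty_Basis by blast
  define p1 where "p1 = p0 + (R / 2) *\<^sub>R e"
  have p: "p0 \<in> \<Omega>" "p1 \<in> \<Omega>" "p0 \<noteq> p1"
    using R e by (auto simp: p1_def subset_iff nonzero_Basis dist_norm)
  define G where "G n = (case n of 0 \<Rightarrow> {f \<in> cont_funs \<Omega>. f p0 \<noteq> f p1}
      | Suc m \<Rightarrow> flat_funs \<Omega> (ball p0 R) ((1/2) ^ m))" for n
  have "comeager_in (compact_open_topology \<Omega>) (\<Inter>n. G n)"
  proof (rule comeager_in_compact_open)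
    show "openin (compact_open_topology \<Omega>) (G n)" for n
      using openin_separating[OF p(1,2)] openin_flat_funs by (cases n) (auto simp: G_def)
    show "\<exists>g\<in>G n. \<forall>x\<in>\<Omega>. \<bar>g x - f x\<bar> < \<epsilon>" if "f \<in> cont_funs \<Omega>" "0 < \<epsilon>" for n f \<epsilon>
      using dense_separating[OF p that] dense_flat_funs[OF R(2,1) that]
      by (cases n) (simp_all add: G_def)
  qed
  moreover have "\<not> sigma_finite_hausdorff (DIM('a) - 1) {x \<in> \<Omega>. little_lip \<phi> \<Omega> f x = \<infinity>}"
    if f: "f \<in> (\<Inter>n. G n)" for f
  proof
    assume E: "sigma_finite_hausdorff (DIM('a) - 1) {x \<in> \<Omega>. little_lip \<phi> \<Omega> f x = \<infinity>}"
    have "f \<in> G 0" using f by blast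
    then have fc: "continuous_on \<Omega> f" and ne: "f p0 \<noteq> f p1" by (auto simp: G_def cont_funs_def)
    have "f \<in> flat_funs \<Omega> (ball p0 R) ((1/2) ^ m)" for m
    proof -
      have "f \<in> G (Suc m)" using f by blast
      then show ?thesis by (simp add: G_def)
    qed
    then have "negligible {x \<in> ball p0 R. \<not> (\<forall>k>0. lower_slope_le f x k)}"
      by (rule lower_slope_le_of_flat[OF lmeasurable_ball])
    moreover have "\<exists>k. lower_slope_le f x k"
      if "x \<in> ball p0 R - {x \<in> \<Omega>. little_lip \<phi> \<Omega> f x = \<infinity>}" for x
      using that R(3) interior_subset[of \<Omega>]
      by (intro lower_slope_le_of_little_lip[OF assms(1,2) fc]) auto
    ultimately have "f p0 = f p1"
      unfolding p1_def by (intro eq_endpoints_of_sigma_finite[OF fc R(3,1) e E])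
    with ne show False by simp
  qed
  ultimately show ?thesis by blast
qed

end
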